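(* Let $m,n\ge 2$ and let $A\in\mathbb{R}^{m\times n}$ preserve Chebyshev systems. Denote by $F$ the set of all $j\in\{1,\dots,n\}$ such that the maximum absolute value element in the column $a_j$ is also the maximum absolute value element in its row. Let $k=|F|$. Then the following statements hold. (i) A pair of vertices $t_1,t_2\in\{-1,1\}^n$ of $G_A$ belong to the same connected component if and only if $(t_1)_j=(t_2)_j$ for all $j\in F$. (ii) Each connected component of $G_A$ has $2^{n-k}$ elements (so there are exactly $2^k$ components in $G_A$). Also each connected component is a tree (apart from loops) and contains exactly one loop vertex. (iii) All components of $G_A$ are isomorphic. More precisely, let $C_1$ and $C_2$ be a pair of connected components. Then for an arbitrary vertex $t_1$ of $C_1$ there is exactly one vertex $t_2$ of $C_2$ such that $d(t_2)=d(t_1)$. The mapping $g$ that maps vertices of $C_1$ into vertices of $C_2$ and satisfies $d(g(t))=d(t)$ for all vertices $t$ of $C_1$ is well-defined and is an isomorphism (of directed graphs) from $C_1$ to $C_2$. (iv) The depth of $G_A$ is equal to the depth of an arbitrary connected component of $G_A$ and is also equal to the depth of $G_A^{sd}$ (which is the maximal possible number of distinct columns visited by the following process for the entrywise absolute value $|A|$: take a column, find the maximum element in it, find the maximum element in the corresponding row, then the maximum element in the corresponding column, and so on).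
   Context: A vector is called Chebyshev if all of its components are non-zero; $\mathrm{Ch}_n$ is the set of Chebyshev vectors in $\mathbb{R}^n$. For $v\in\mathrm{Ch}_n$, $\mathcal{S}(v)\in\{-1,1\}^n$ is the vector of signs, $\mathcal{S}(v)_i=\operatorname{sign}(v_i)$. For $a\in\mathbb{R}^n$ and $v\in\mathrm{Ch}_n$ (any $n\ge 2$), $\mu(a,v)$ is the unique real number with $\|a-\mu(a,v)v\|_\infty=\inf_{t\in\mathbb{R}}\|a-tv\|_\infty$ (it exists and is unique). Denote by $a^i$ the $i$-th row and by $a_j$ the $j$-th column of $A$. For $v\in\mathrm{Ch}_n$, $\phi(A,v)\in\mathbb{R}^m$ is defined by $\phi(A,v)_i=\mu(a^i,v)$; for $u\in\mathrm{Ch}_m$, $\psi(A,u)\in\mathbb{R}^n$ is defined by $\psi(A,u)_j=\mu(a_j,u)$. $A$ preserves Chebyshev systems if $\phi(A,v)\in\mathrm{Ch}_m$ for all $v\in\mathrm{Ch}_n$ and $\psi(A,u)\in\mathrm{Ch}_n$ for all $u\in\mathrm{Ch}_m$. For such $A$, each row and each column has exactly one entry of maximal absolute value, and that entry is non-zero; let $\mathfrak{j}(i)$ be the position of this entry in row $a^i$ and $\mathfrak{i}(j)$ the position of this entry in column $a_j$. Define $\mathcal{T}(q)=\mathcal{S}(\phi(A,q))$ for $q\in\{-1,1\}^n$, $\mathcal{R}(p)=\mathcal{S}(\psi(A,p))$ for $p\in\{-1,1\}^m$, and $\mathcal{V}=\mathcal{R}\circ\mathcal{T}$. The sign transition graph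 $G_A$ is the directed graph with vertex set $\{-1,1\}^n$ and an edge $t_1\to t_2$ if and only if $\mathcal{V}(t_1)=t_2$. The sign dependency graph $G_A^{sd}$ is the directed graph with vertex set $\{1,\dots,n\}$ and an edge from $k$ to $l$ if and only if $k=\mathfrak{j}(\mathfrak{i}(l))$. A loop vertex is a vertex $t$ with an edge $t\to t$. Connected components are weakly connected components (edge directions ignored). "Tree" is understood disregarding loops. The depth of a directed graph is the maximal $p$ such that there exist distinct vertices $t_1,\dots,t_p$ with an edge $t_k\to t_{k+1}$ for all $k=1,\dots,p-1$. For $t\in\{-1,1\}^n$ the sequence $t,\mathcal{V}(t),\mathcal{V}^2(t),\dots$ is eventually constant; $f(t)$ denotes its eventual value, which is a loop vertex. The function $d:\{-1,1\}^n\to\{-1,1\}^n$ is defined by $d(t)_i=t_i/f(t)_i$. *)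

theory Defs
  imports "HOL-Analysis.Analysis" "Graph_Theory.Graph_Theory"
begin

text \<open>An \<open>m \<times> n\<close> matrix is an element of \<open>real ^ 'n ^ 'm\<close>.\<close>

definition Ch :: "(real ^ 'k) set" where
  "Ch = {v. \<forall>i. v $ i \<noteq> 0}"

definition sign_vec :: "real ^ 'k \<Rightarrow> real ^ 'k" where
  "sign_vec v = (\<chi> i. sgn (v $ i))"

definition sign_vecs :: "(real ^ 'k) set" where
  "sign_vecs = {t. \<forall>i. t $ i \<in> {-1, 1}}"

definition mu :: "real ^ 'k \<Rightarrow> real ^ 'k \<Rightarrow> real" where
  "mu a v = (THE s. infnorm (a - s *\<^sub>R v) = (INF t. infnorm (a - t *\<^sub>R v)))"

definition phi :: "real ^ 'n ^ 'm \<Rightarrow> real ^ 'n \<Rightarrow> real ^ 'm" where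
  "phi A v = (\<chi> i. mu (row i A) v)"

definition psi :: "real ^ 'n ^ 'm \<Rightarrow> real ^ 'm \<Rightarrow> real ^ 'n" where
  "psi A u = (\<chi> j. mu (column j A) u)"

definition preserves_Chebyshev :: "real ^ 'n ^ 'm \<Rightarrow> bool" where
  "preserves_Chebyshev A \<longleftrightarrow> (\<forall>v \<in> Ch. phi A v \<in> Ch) \<and> (\<forall>u \<in> Ch. psi A u \<in> Ch)"

definition mat_abs :: "real ^ 'n ^ 'm \<Rightarrow> real ^ 'n ^ 'm" where
  "mat_abs A = (\<chi> i j. \<bar>A $ i $ j\<bar>)"

definition max_in_row :: "real ^ 'n ^ 'm \<Rightarrow> 'm \<Rightarrow> 'n" where
  "max_in_row B i = (THE j. \<forall>j'. B $ i $ j' \<le> B $ i $ j)"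

definition max_in_col :: "real ^ 'n ^ 'm \<Rightarrow> 'n \<Rightarrow> 'm" where
  "max_in_col B j = (THE i. \<forall>i'. B $ i' $ j \<le> B $ i $ j)"

text \<open>The functions \<open>\<jj>\<close> and \<open>\<ii>\<close>.\<close>

definition jpos :: "real ^ 'n ^ 'm \<Rightarrow> 'm \<Rightarrow> 'n" where
  "jpos A i = max_in_row (mat_abs A) i"

definition ipos :: "real ^ 'n ^ 'm \<Rightarrow> 'n \<Rightarrow> 'm" where
  "ipos A j = max_in_col (mat_abs A) j"

definition T_map :: "real ^ 'n ^ 'm \<Rightarrow> real ^ 'n \<Rightarrow> real ^ 'm" where
  "T_map A q = sign_vec (phi A q)"

definition R_map :: "real ^ 'n ^ 'm \<Rightarrow> real ^ 'm \<Rightarrow> real ^ 'n" where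
  "R_map A p = sign_vec (psi A p)"

definition V_map :: "real ^ 'n ^ 'm \<Rightarrow> real ^ 'n \<Rightarrow> real ^ 'n" where
  "V_map A = R_map A \<circ> T_map A"

definition sign_transition_graph ::
    "real ^ 'n ^ 'm \<Rightarrow> (real ^ 'n, (real ^ 'n) \<times> (real ^ 'n)) pre_digraph" where
  "sign_transition_graph A = with_proj
     \<lparr> pverts = sign_vecs,
       parcs = {(t1, t2). t1 \<in> sign_vecs \<and> t2 \<in> sign_vecs \<and> V_map A t1 = t2} \<rparr>"

definition sign_dependency_graph :: "real ^ 'n ^ 'm \<Rightarrow> ('n, 'n \<times> 'n) pre_digraph" where
  "sign_dependency_graph A = with_proj
     \<lparr> pverts = UNIV, parcs = {(k, l). k = jpos A (ipos A l)} \<rparr>"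

definition eventual :: "real ^ 'n ^ 'm \<Rightarrow> real ^ 'n \<Rightarrow> real ^ 'n" where
  "eventual A t = (THE w. \<forall>\<^sub>F r in sequentially. (V_map A ^^ r) t = w)"

definition d_map :: "real ^ 'n ^ 'm \<Rightarrow> real ^ 'n \<Rightarrow> real ^ 'n" where
  "d_map A t = (\<chi> i. t $ i / eventual A t $ i)"

text \<open>\<^const>\<open>Digraph_Component.connected\<close> is weak connectivity (and requires a vertex).\<close>

definition weak_components :: "('a, 'b) pre_digraph \<Rightarrow> ('a, 'b) pre_digraph set" where
  "weak_components G = {C. pre_digraph.max_subgraph G Digraph_Component.connected C}"

definition loop_vertex :: "('a, 'b) pre_digraph \<Rightarrow> 'a \<Rightarrow> bool" where
  "loop_vertex G t \<longleftrightarrow> t \<in> verts G \<and> t \<rightarrow>\<^bsub>G\<^esub> t"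

definition remove_loops :: "('a, 'b) pre_digraph \<Rightarrow> ('a, 'b) pre_digraph" where
  "remove_loops G = G\<lparr> arcs := {e \<in> arcs G. tail G e \<noteq> head G e} \<rparr>"

text \<open>
  The library's \<^const>\<open>Digraph_Component.tree\<close> only excludes directed cycles. Here the underlying
  undirected graph has to be a tree. In the symmetrised digraph a single undirected edge is a cycle
  of length 2, so only cycles of length at least 3 count there; a pair of opposite arcs of \<open>G\<close>,
  which symmetrisation would merge into one edge, is excluded by antisymmetry. Parallel arcs are not
  excluded, but the graphs considered here have none.
\<close>

definition undirected_tree :: "('a, 'b) pre_digraph \<Rightarrow> bool" where
  "undirected_tree G \<longleftrightarrow>
     Digraph_Component.connected G \<and> antisym (arcs_ends G) \<and>
     \<not> (\<exists>p. pre_digraph.cycle (with_proj (mk_symmetric G)) p \<and> length p \<ge> 3)"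

definition tree_apart_from_loops :: "('a, 'b) pre_digraph \<Rightarrow> bool" where
  "tree_apart_from_loops G \<longleftrightarrow> undirected_tree (remove_loops G)"

definition depth :: "('a, 'b) pre_digraph \<Rightarrow> nat" where
  "depth G = Max {length p | p. vpath p G}"

text \<open>The vertex map \<open>g\<close> (together with some map on arcs) is an isomorphism from \<open>G\<close> to \<open>H\<close>.\<close>

definition isomorphism_via ::
    "('a \<Rightarrow> 'c) \<Rightarrow> ('a, 'b) pre_digraph \<Rightarrow> ('c, 'd) pre_digraph \<Rightarrow> bool" where
  "isomorphism_via g G H \<longleftrightarrow>
     (\<exists>h. pre_digraph.digraph_isomorphism G h \<and> iso_verts h = g \<and> H = app_iso h G)"

text \<open>
  The columns met when one starts in column \<open>j\<close> and repeatedly passes to the row of the maximum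
  element of the current column and then to the column of the maximum element of that row.
\<close>

definition visited_columns :: "real ^ 'n ^ 'm \<Rightarrow> 'n \<Rightarrow> 'n set" where
  "visited_columns B j = {((\<lambda>l. max_in_row B (max_in_col B l)) ^^ r) j | r. True}"

end

theory Submission
  imports Defs
begin

text \<open>
  Preservation of Chebyshev systems forces every row and every column to have a unique non-zero
  entry of maximal modulus, and then the sign of the best coefficient \<open>mu a v\<close> is the product of the
  signs of \<open>a\<close> and \<open>v\<close> at the dominant position of \<open>a\<close> (\<open>dominant_entry_exists\<close>,
  \<open>sgn_mu_dominant\<close>). The map \<open>V_map\<close> thus becomes purely combinatorial: with \<open>h l = jpos A (ipos A l)\<close>
  and constant signs \<open>c l\<close>, which are \<open>1\<close> when \<open>h l = l\<close>, it sends \<open>t\<close> to the vector with components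
  \<open>c l * t $ h l\<close> (\<open>V_map_nth\<close>).

  The moduli of the column maxima increase strictly along \<open>h\<close> until a fixed point is reached
  (\<open>column_max_increases\<close>), and the fixed points of \<open>h\<close> are the elements of \<open>F\<close>. Let \<open>K\<close> be the least
  time after which all \<open>h\<close>-orbits rest. After \<open>K\<close> steps of \<open>V_map\<close> each component is, up to a constant
  sign, a component of the original vector with index in \<open>F\<close>, so every sign vector reaches a fixed
  point, and this fixed point is determined by the signs on \<open>F\<close>, which never change.

  For any map whose orbits end in fixed points, the weak components of its graph are the basins of
  the fixed points (\<open>weak_components_function_graph\<close>), and each basin is a tree directed towards its
  single loop (\<open>tree_basin\<close>). A basin of \<open>V_map\<close> consists of the sign vectors with prescribed signs on
  \<open>F\<close>; this gives the description and the number of the components and their sizes.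

  Dividing a vector by its limit cancels the signs \<open>c l\<close>: the quotient \<open>d\<close> evolves by
  \<open>d (V_map A t) = d t \<circ> h\<close> in every component (\<open>deviation_step\<close>). Multiplying \<open>d t\<close> by the loop
  vertex of another component therefore gives the isomorphism between the two
  (\<open>transport_isomorphism\<close>).

  Finally, a map that settles exactly at time \<open>K\<close> has a graph of depth \<open>K + 1\<close>
  (\<open>depth_function_graph\<close>). This applies to \<open>h\<close>, whose graph is the reversed dependency graph, and to
  \<open>V_map\<close> on every component, where the vector that differs from the loop vertex everywhere outside
  \<open>F\<close> needs the full time \<open>K\<close> (\<open>late_vertex_in_basin\<close>).
\<close>

section \<open>Best approximation by multiples of a Chebyshev vector\<close>

lemma infnorm_attained:
  fixes x :: "real ^ 'k"
  shows "\<exists>i. infnorm x = \<bar>x $ i\<bar>"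
proof -
  have "infnorm x = Max (range (\<lambda>i. \<bar>x $ i\<bar>))"
    unfolding infnorm_cart by (simp add: cSup_eq_Max full_SetCompr_eq)
  moreover have "Max (range (\<lambda>i. \<bar>x $ i\<bar>)) \<in> range (\<lambda>i. \<bar>x $ i\<bar>)"
    by (rule Max_in) auto
  ultimately show ?thesis by (metis imageE)
qed

definition best_coeff :: "real ^ 'k \<Rightarrow> real ^ 'k \<Rightarrow> real \<Rightarrow> bool" where
  "best_coeff a v s \<longleftrightarrow> (\<forall>t. infnorm (a - s *\<^sub>R v) \<le> infnorm (a - t *\<^sub>R v))"

text \<open>
  The error is continuous in the coefficient and, because some component of \<open>v\<close> is non-zero,
  exceeds its value at \<open>0\<close> outside a bounded interval.
\<close>

lemma best_coeff_exists:
  assumes "v \<in> Ch"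
  shows "\<exists>s. best_coeff a v s"
proof -
  fix i :: 'a
  define f where "f = (\<lambda>t. infnorm (a - t *\<^sub>R v))"
  \<comment> \<open>beyond \<open>R\<close> the \<open>i\<close>-th component alone has an error larger than \<open>infnorm a\<close>\<close>
  define R where "R = 2 * infnorm a / \<bar>v $ i\<bar>"
  have vi: "\<bar>v $ i\<bar> > 0" using assms by (auto simp: Ch_def)
  have R0: "R \<ge> 0" by (simp add: R_def infnorm_pos_le)
  have "continuous_on {-R..R} f"
    unfolding f_def by (intro continuous_intros)
  then obtain s where s: "s \<in> {-R..R}" "\<And>t. t \<in> {-R..R} \<Longrightarrow> f s \<le> f t"
    using continuous_attains_inf[of "{-R..R}" f] R0 by auto
  have "f s \<le> f t" for t
  proof (cases "t \<in> {-R..R}")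
    case False
    then have "R < \<bar>t\<bar>" by auto
    then have "2 * infnorm a < \<bar>t\<bar> * \<bar>v $ i\<bar>"
      using vi by (simp add: R_def field_simps)
    moreover have "\<bar>t * v $ i\<bar> - \<bar>a $ i\<bar> \<le> \<bar>(a - t *\<^sub>R v) $ i\<bar>" by simp
    moreover have "\<bar>(a - t *\<^sub>R v) $ i\<bar> \<le> f t"
      unfolding f_def by (rule component_le_infnorm_cart)
    moreover have "\<bar>a $ i\<bar> \<le> infnorm a" by (rule component_le_infnorm_cart)
    moreover have "f s \<le> f 0" using s(2)[of 0] R0 by simp
    moreover have "f 0 = infnorm a" by (simp add: f_def)
    ultimately show ?thesis by (simp add: abs_mult)
  qed (use s in auto)
  then show ?thesis by (auto simp: best_coeff_def f_def)
qed

text \<open>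
  The error at the midpoint of two optimal coefficients would be smaller than at both: every
  component of \<open>v\<close> is non-zero, so in each component two distinct numbers from an interval
  symmetric about \<open>0\<close> are averaged, which gives an interior point.
\<close>

lemma best_coeff_unique:
  assumes v: "v \<in> Ch" and s: "best_coeff a v s" and s': "best_coeff a v s'"
  shows "s = s'"
proof (rule ccontr)
  assume neq: "s \<noteq> s'"
  define m where "m = (s + s') / 2"
  define E where "E = infnorm (a - s *\<^sub>R v)"
  have E': "E = infnorm (a - s' *\<^sub>R v)"
    using s s' unfolding best_coeff_def E_def by (meson order_antisym)
  obtain i where i: "infnorm (a - m *\<^sub>R v) = \<bar>(a - m *\<^sub>R v) $ i\<bar>"
    using infnorm_attained by blast
  have midpoint: "\<bar>b - z\<bar> < E"
    if "\<bar>b - x\<bar> \<le> E" "\<bar>b - y\<bar> \<le> E" "x \<noteq> y" "2 * z = x + y" for b x y z :: real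
    using that by (cases "x < y") linarith+
  have "\<bar>a $ i - s * v $ i\<bar> \<le> E" "\<bar>a $ i - s' * v $ i\<bar> \<le> E"
    using component_le_infnorm_cart[of "a - s *\<^sub>R v" i]
      component_le_infnorm_cart[of "a - s' *\<^sub>R v" i] E' by (auto simp: E_def)
  moreover have "s * v $ i \<noteq> s' * v $ i" using neq v by (auto simp: Ch_def)
  moreover have "2 * (m * v $ i) = s * v $ i + s' * v $ i"
    by (simp add: m_def field_simps)
  ultimately have "\<bar>a $ i - m * v $ i\<bar> < E"
    by (rule midpoint)
  with i have "infnorm (a - m *\<^sub>R v) < E" by simp
  moreover have "E \<le> infnorm (a - m *\<^sub>R v)" using s by (simp add: best_coeff_def E_def)
  ultimately show False by simp
qed

lemma attains_INF_iff_best_coeff: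
  "infnorm (a - s *\<^sub>R v) = (INF t. infnorm (a - t *\<^sub>R v)) \<longleftrightarrow> best_coeff a v s"
proof -
  have bdd: "bdd_below (range (\<lambda>t. infnorm (a - t *\<^sub>R v)))"
    by (rule bdd_belowI2[of _ 0]) (rule infnorm_pos_le)
  show ?thesis
  proof
    assume "infnorm (a - s *\<^sub>R v) = (INF t. infnorm (a - t *\<^sub>R v))"
    then show "best_coeff a v s"
      by (auto simp: best_coeff_def intro: cINF_lower[OF bdd])
  next
    assume "best_coeff a v s"
    then show "infnorm (a - s *\<^sub>R v) = (INF t. infnorm (a - t *\<^sub>R v))"
      by (intro antisym cINF_greatest cINF_lower bdd) (auto simp: best_coeff_def)
  qed
qed

lemma best_coeff_mu: "v \<in> Ch \<Longrightarrow> best_coeff a v (mu a v)"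
  unfolding mu_def attains_INF_iff_best_coeff
  by (rule theI') (metis best_coeff_exists best_coeff_unique)

lemma mu_eqI: "v \<in> Ch \<Longrightarrow> best_coeff a v s \<Longrightarrow> mu a v = s"
  using best_coeff_mu best_coeff_unique by blast

definition dominant :: "real ^ 'k \<Rightarrow> 'k \<Rightarrow> bool" where
  "dominant a j \<longleftrightarrow> a $ j \<noteq> 0 \<and> (\<forall>i. i \<noteq> j \<longrightarrow> \<bar>a $ i\<bar> < \<bar>a $ j\<bar>)"

text \<open>
  If the maximum modulus of \<open>a\<close> were attained at two positions \<open>i\<close> and \<open>j\<close>, signs for \<open>v\<close> could be
  chosen there so that a positive multiple of \<open>v\<close> worsens the error in one of the two positions and
  a negative multiple worsens it in the other; then the coefficient \<open>0\<close> would be optimal, as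
  it also is for \<open>a = 0\<close>.
\<close>

lemma dominant_entry_exists:
  assumes nz: "\<And>v. v \<in> Ch \<Longrightarrow> mu a v \<noteq> 0"
  shows "\<exists>j. dominant a j"
proof -
  obtain j where j: "infnorm a = \<bar>a $ j\<bar>" using infnorm_attained by blast
  have le: "\<bar>a $ i\<bar> \<le> \<bar>a $ j\<bar>" for i
    using component_le_infnorm_cart[of a i] j by simp
  have "\<bar>a $ i\<bar> < \<bar>a $ j\<bar>" if "i \<noteq> j" for i
  proof (rule ccontr)
    assume "\<not> \<bar>a $ i\<bar> < \<bar>a $ j\<bar>"
    with le[of i] have eq: "\<bar>a $ i\<bar> = \<bar>a $ j\<bar>" by simp
    define v :: "real ^ 'a" where
      "v = (\<chi> l. if l = i then (if a $ i \<ge> 0 then 1 else -1)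
              else if l = j then (if a $ j \<ge> 0 then -1 else 1) else 1)"
    have v: "v \<in> Ch" by (simp add: Ch_def v_def)
    have "infnorm a \<le> infnorm (a - t *\<^sub>R v)" for t
    proof (cases "t \<le> 0")
      case True
      then have "\<bar>a $ i\<bar> \<le> \<bar>(a - t *\<^sub>R v) $ i\<bar>" by (auto simp: v_def)
      then show ?thesis using component_le_infnorm_cart[of "a - t *\<^sub>R v" i] eq j by simp
    next
      case False
      then have "\<bar>a $ j\<bar> \<le> \<bar>(a - t *\<^sub>R v) $ j\<bar>" using that by (auto simp: v_def)
      then show ?thesis using component_le_infnorm_cart[of "a - t *\<^sub>R v" j] j by simp
    qed
    then have "mu a v = 0" by (intro mu_eqI v) (simp add: best_coeff_def)
    with nz[OF v] show False by simp
  qed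
  moreover have "a $ j \<noteq> 0"
  proof
    assume "a $ j = 0"
    with j have "best_coeff a (\<chi> i. 1) 0" by (simp add: best_coeff_def infnorm_pos_le)
    then have "mu a (\<chi> i. 1) = 0" by (intro mu_eqI) (simp_all add: Ch_def)
    moreover have "(\<chi> i. 1) \<in> Ch" by (simp add: Ch_def)
    ultimately show False using nz by blast
  qed
  ultimately show ?thesis by (auto simp: dominant_def)
qed

text \<open>
  Near the coefficient \<open>0\<close> the error is governed by the dominant position alone. It decreases when
  the coefficient moves in the direction \<open>sgn (a $ j) * sgn (v $ j)\<close>, whereas every coefficient
  that is zero or of the opposite sign leaves an error of at least \<open>\<bar>a $ j\<bar>\<close> in that position.
\<close>

lemma sgn_mu_dominant:
  assumes v: "v \<in> Ch" and dom: "dominant a j"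
  shows "sgn (mu a v) = sgn (a $ j) * sgn (v $ j)"
proof -
  define s where "s = sgn (a $ j) * sgn (v $ j)"
  have vj: "v $ j \<noteq> 0" using v by (simp add: Ch_def)
  have aj: "a $ j \<noteq> 0" using dom by (simp add: dominant_def)
  \<comment> \<open>a small step in the direction \<open>s\<close> brings all components below \<open>\<bar>a $ j\<bar>\<close>: the dominant one
    decreases, the others stay below by continuity\<close>
  have "\<forall>\<^sub>F e in at_right 0. \<bar>a $ i - e * s * v $ i\<bar> < \<bar>a $ j\<bar>" for i
  proof (cases "i = j")
    case True
    have "\<forall>\<^sub>F e in at_right 0. e < \<bar>a $ j\<bar> / \<bar>v $ j\<bar>"
      using aj vj by (intro eventually_at_right_real[THEN eventually_mono]) auto
    then show ?thesis
      using eventually_at_right_less[of "0::real"]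
    proof eventually_elim
      case (elim e)
      then have "e * \<bar>v $ j\<bar> < \<bar>a $ j\<bar>" "0 < e * \<bar>v $ j\<bar>" using vj by (auto simp: field_simps)
      then show ?case using True aj vj
        by (cases "a $ j > 0"; cases "v $ j > 0") (auto simp: s_def sgn_if)
    qed
  next
    case False
    have "((\<lambda>e. \<bar>a $ i - e * s * v $ i\<bar>) \<longlongrightarrow> \<bar>a $ i - 0 * s * v $ i\<bar>) (at_right 0)"
      by (intro tendsto_intros)
    then show ?thesis
      by (rule order_tendstoD) (use dom False in \<open>simp add: dominant_def\<close>)
  qed
  then have "\<forall>\<^sub>F e in at_right 0. \<forall>i. \<bar>a $ i - e * s * v $ i\<bar> < \<bar>a $ j\<bar>"
    by (rule eventually_all_finite)
  then obtain e where e: "\<And>i. \<bar>a $ i - e * s * v $ i\<bar> < \<bar>a $ j\<bar>"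
    using eventually_happens[of _ "at_right (0::real)"] by auto
  obtain i where "infnorm (a - (e * s) *\<^sub>R v) = \<bar>(a - (e * s) *\<^sub>R v) $ i\<bar>"
    using infnorm_attained by blast
  with e have "infnorm (a - (e * s) *\<^sub>R v) < \<bar>a $ j\<bar>" by simp
  then have "infnorm (a - mu a v *\<^sub>R v) < \<bar>a $ j\<bar>"
    using best_coeff_mu[OF v, of a] unfolding best_coeff_def by (meson le_less_trans)
  then have "\<bar>a $ j - mu a v * v $ j\<bar> < \<bar>a $ j\<bar>"
    using component_le_infnorm_cart[of "a - mu a v *\<^sub>R v" j] by simp
  then have "sgn (mu a v * v $ j) = sgn (a $ j)" 
    by (auto simp: sgn_if split: if_splits)
  then have "sgn (mu a v) * (sgn (v $ j) * sgn (v $ j)) = sgn (a $ j) * sgn (v $ j)"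
    by (simp only: sgn_mult flip: mult.assoc)
  moreover have "sgn (v $ j) * sgn (v $ j) = 1" using vj by (simp add: sgn_if)
  ultimately show ?thesis by (simp only: mult_1_right)
qed

text \<open>
  Identifies a dominant position with the one that \<open>max_in_row\<close> and \<open>max_in_col\<close> describe.
\<close>

lemma abs_dominant_iff:
  assumes "dominant a j"
  shows "(\<forall>i. \<bar>a $ i\<bar> \<le> \<bar>a $ l\<bar>) \<longleftrightarrow> l = j"
  using assms unfolding dominant_def by (metis linorder_not_less order_less_imp_le order_refl)

section \<open>The sign transition rule of a matrix\<close>

lemma dominant_jpos:
  assumes "preserves_Chebyshev A"
  shows "dominant (row i A) (jpos A i)"
proof -
  have "mu (row i A) v \<noteq> 0" if "v \<in> Ch" for v
    using assms that by (auto simp: preserves_Chebyshev_def phi_def Ch_def)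
  then obtain j where j: "dominant (row i A) j" using dominant_entry_exists by blast
  then have "jpos A i = j"
    using abs_dominant_iff[OF j] by (simp add: jpos_def max_in_row_def mat_abs_def row_def)
  with j show ?thesis by simp
qed

lemma dominant_ipos:
  assumes "preserves_Chebyshev A"
  shows "dominant (column j A) (ipos A j)"
proof -
  have "mu (column j A) u \<noteq> 0" if "u \<in> Ch" for u
    using assms that by (auto simp: preserves_Chebyshev_def psi_def Ch_def)
  then obtain i where i: "dominant (column j A) i" using dominant_entry_exists by blast
  then have "ipos A j = i"
    using abs_dominant_iff[OF i] by (simp add: ipos_def max_in_col_def mat_abs_def column_def)
  with i show ?thesis by simp
qed

lemma sign_vecs_nth: "t \<in> sign_vecs \<Longrightarrow> t $ i = 1 \<or> t $ i = -1"
  by (auto simp: sign_vecs_def)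

lemma sign_vecs_subset_Ch: "sign_vecs \<subseteq> (Ch :: (real ^ 'k) set)"
proof
  fix t :: "real ^ 'k" assume "t \<in> sign_vecs"
  then have "t $ i \<noteq> 0" for i using sign_vecs_nth[of t i] by auto
  then show "t \<in> Ch" by (simp add: Ch_def)
qed

lemma sign_vec_in_sign_vecs: "v \<in> Ch \<Longrightarrow> sign_vec v \<in> sign_vecs"
  by (auto simp: sign_vecs_def Ch_def sign_vec_def sgn_if)

lemma T_map_in_sign_vecs:
  assumes "preserves_Chebyshev A" "q \<in> sign_vecs"
  shows "T_map A q \<in> sign_vecs"
  using assms sign_vecs_subset_Ch
  by (auto simp: T_map_def preserves_Chebyshev_def intro!: sign_vec_in_sign_vecs)

text \<open>
  The dependency graph has the arc from \<open>column_successor A l\<close> to \<open>l\<close>: the new sign in column \<open>l\<close>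
  is read off from the old sign in column \<open>column_successor A l\<close>.
\<close>

definition column_successor :: "real ^ 'n ^ 'm \<Rightarrow> 'n \<Rightarrow> 'n" where
  "column_successor A l = jpos A (ipos A l)"

definition transfer_sign :: "real ^ 'n ^ 'm \<Rightarrow> 'n \<Rightarrow> real" where
  "transfer_sign A l = sgn (A $ ipos A l $ l) * sgn (A $ ipos A l $ column_successor A l)"

text \<open>
  By \<open>sgn_mu_dominant\<close>, \<open>T_map\<close> gives row \<open>i\<close> the sign in column \<open>jpos A i\<close> times the sign of the
  dominant entry of that row, and \<open>R_map\<close> acts in the same way on columns.
\<close>

lemma V_map_nth:
  assumes A: "preserves_Chebyshev A" and q: "q \<in> sign_vecs"
  shows "V_map A q $ l = transfer_sign A l * q $ column_successor A l"
proof -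
  have T: "T_map A q $ i = sgn (A $ i $ jpos A i) * q $ jpos A i" for i
  proof -
    have "sgn (q $ jpos A i) = q $ jpos A i"
      using sign_vecs_nth[OF q, of "jpos A i"] by auto
    then show ?thesis
      using sgn_mu_dominant[OF _ dominant_jpos[OF A], of q i] q sign_vecs_subset_Ch
      by (auto simp: T_map_def phi_def sign_vec_def row_def)
  qed
  let ?p = "T_map A q"
  have p: "?p \<in> sign_vecs" by (rule T_map_in_sign_vecs[OF A q])
  have "sgn (?p $ ipos A l) = ?p $ ipos A l"
    using sign_vecs_nth[OF p, of "ipos A l"] by auto
  then have "V_map A q $ l = sgn (A $ ipos A l $ l) * ?p $ ipos A l"
    using sgn_mu_dominant[OF _ dominant_ipos[OF A], of ?p l] p sign_vecs_subset_Ch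
    by (auto simp: V_map_def R_map_def psi_def sign_vec_def column_def)
  then show ?thesis by (simp add: T transfer_sign_def column_successor_def)
qed

lemma transfer_sign_cases:
  assumes "preserves_Chebyshev A"
  shows "transfer_sign A l \<in> {-1, 1}"
  using dominant_jpos[OF assms, of "ipos A l"] dominant_ipos[OF assms, of l]
  by (auto simp: transfer_sign_def column_successor_def dominant_def row_def column_def sgn_if)

lemma transfer_sign_fixed:
  assumes "preserves_Chebyshev A" "column_successor A l = l"
  shows "transfer_sign A l = 1"
  using dominant_ipos[OF assms(1), of l] assms(2)
  by (auto simp: transfer_sign_def dominant_def column_def sgn_if)

text \<open>
  The column maximum is a potential for \<open>column_successor\<close>: passing to the dominant entry of the
  row, and then to that of its column, never decreases the modulus, and strictly increases it when
  the column changes. This is what excludes all cycles except fixed columns.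
\<close>

lemma column_max_increases:
  assumes A: "preserves_Chebyshev A" and neq: "column_successor A l \<noteq> l"
  shows "\<bar>A $ ipos A l $ l\<bar> < \<bar>A $ ipos A (column_successor A l) $ column_successor A l\<bar>"
proof -
  let ?l' = "column_successor A l"
  have "\<bar>A $ ipos A l $ l\<bar> < \<bar>A $ ipos A l $ ?l'\<bar>"
    using dominant_jpos[OF A, of "ipos A l"] neq
    by (auto simp: dominant_def row_def column_successor_def)
  also have "\<dots> \<le> \<bar>A $ ipos A ?l' $ ?l'\<bar>"
    using dominant_ipos[OF A, of ?l']
    by (cases "ipos A l = ipos A ?l'") (auto simp: dominant_def column_def less_imp_le)
  finally show ?thesis .
qed

section \<open>Graphs of functions\<close>

lemma funpow_fixed_stable:
  assumes "f ((f ^^ r) x) = (f ^^ r) x" and "r \<le> s"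
  shows "(f ^^ s) x = (f ^^ r) x"
  using assms(2) by (induction s rule: dec_induct) (simp_all add: assms(1))

definition function_graph :: "'a set \<Rightarrow> ('a \<Rightarrow> 'a) \<Rightarrow> ('a, 'a \<times> 'a) pre_digraph" where
  "function_graph S f = with_proj \<lparr> pverts = S, parcs = (\<lambda>x. (x, f x)) ` S \<rparr>"

lemma function_graph_simps [simp]:
  "verts (function_graph S f) = S"
  "arcs (function_graph S f) = (\<lambda>x. (x, f x)) ` S"
  "arcs_ends (function_graph S f) = (\<lambda>x. (x, f x)) ` S"
  "tail (function_graph S f) = fst"
  "head (function_graph S f) = snd"
  by (simp_all add: function_graph_def)

lemma wf_function_graph: "(\<And>x. x \<in> S \<Longrightarrow> f x \<in> S) \<Longrightarrow> wf_digraph (function_graph S f)"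
  by unfold_locales auto

text \<open>
  Since the arcs of a function graph are the pairs \<open>(x, f x)\<close>, a bijection that commutes with the
  two functions carries arcs to arcs componentwise.
\<close>

lemma isomorphism_via_function_graph:
  assumes closed: "\<And>x. x \<in> S \<Longrightarrow> f x \<in> S"
    and g: "bij_betw g S S'"
    and comm: "\<And>x. x \<in> S \<Longrightarrow> g (f x) = f' (g x)"
  shows "isomorphism_via g (function_graph S f) (function_graph S' f')"
proof -
  define h where
    "h = \<lparr> iso_verts = g, iso_arcs = map_prod g g, iso_head = snd, iso_tail = fst \<rparr>"
  have S': "S' = g ` S" using g by (simp add: bij_betw_def)
  have "pre_digraph.digraph_isomorphism (function_graph S f) h"
    unfolding pre_digraph.digraph_isomorphism_def
    using g closed by (auto simp: h_def bij_betw_def inj_on_def intro: wf_function_graph)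
  moreover have "function_graph S' f' = app_iso h (function_graph S f)"
    by (rule pre_digraph.equality) (auto simp: h_def S' comm image_iff)
  ultimately show ?thesis unfolding isomorphism_via_def by (intro exI[of _ h]) (simp add: h_def)
qed

lemma subgraph_antisymmetric: "subgraph G H \<Longrightarrow> subgraph H G \<Longrightarrow> G = H"
  by (rule pre_digraph.equality) (auto simp: subgraph_def compatible_def)

text \<open>
  Iterating \<open>f\<close> joins every vertex to \<open>w\<close>. Points with \<open>f x = x\<close> need no arc, so the lemma applies
  before and after the removal of loops.
\<close>

lemma connected_towards_root:
  assumes root: "w \<in> verts G"
    and reaches: "\<And>x. x \<in> verts G \<Longrightarrow> \<exists>r. (f ^^ r) x = w"
    and step: "\<And>x. x \<in> verts G \<Longrightarrow> f x \<in> verts G \<and> (f x = x \<or> (x, f x) \<in> arcs_ends G)"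
  shows "Digraph_Component.connected G"
proof -
  let ?R = "rtrancl_on (verts G) ((arcs_ends G)\<^sup>s)"
  have to_root: "(x, w) \<in> ?R" if "x \<in> verts G" "(f ^^ r) x = w" for r x
    using that
  proof (induction r arbitrary: x)
    case 0
    then show ?case by simp
  next
    case (Suc r)
    then have "(f x, w) \<in> ?R" using step[of x] by (simp add: funpow_swap1)
    then show ?case
      using step[of x] Suc.prems(1)
      by (auto simp: symcl_def intro: converse_rtrancl_on_into_rtrancl_on)
  qed
  have "sym ((arcs_ends G)\<^sup>s)" by (auto simp: symcl_def sym_def)
  then have "sym ?R" by (rule rtrancl_on_sym)
  with to_root reaches have "(u, v) \<in> ?R" if "u \<in> verts G" "v \<in> verts G" for u v
    using that by (meson rtrancl_on_trans symD)
  then show ?thesis using root by (auto simp: connected_conv)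
qed

lemma vpath_iff:
  "vpath p G \<longleftrightarrow> p \<noteq> [] \<and> set p \<subseteq> verts G \<and> distinct p \<and>
    successively (\<lambda>x y. (x, y) \<in> arcs_ends G) p"
proof -
  have "set (vwalk_arcs p) \<subseteq> arcs_ends G \<longleftrightarrow> successively (\<lambda>x y. (x, y) \<in> arcs_ends G) p"
    by (induction p rule: vwalk_arcs.induct) auto
  then show ?thesis by (auto simp: vpath_def vwalk_def)
qed

lemma depth_reversed:
  assumes "verts H = verts G" "arcs_ends H = (arcs_ends G)\<inverse>"
  shows "depth H = depth G"
proof -
  have *: "vpath (rev p) H \<longleftrightarrow> vpath p G" for p
    by (simp add: vpath_iff assms)
  have "{length p | p. vpath p H} = {length p | p. vpath p G}"
    by (metis (no_types, opaque_lifting) * length_rev rev_rev_ident)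
  then show ?thesis by (simp add: depth_def)
qed

text \<open>
  The library describes a cycle by its arcs. Extremal arguments need its vertices in cyclic order;
  they are the heads of these arcs.
\<close>

lemma mk_symmetric_cycle_vertices:
  assumes "pre_digraph.cycle (with_proj (mk_symmetric G)) p"
  obtains vs where "length vs = length p" "distinct vs"
    "\<And>i. i < length p \<Longrightarrow> (vs ! i, vs ! (Suc i mod length p)) \<in> parcs (mk_symmetric G)"
proof -
  from assms obtain u where u: "pre_digraph.awalk (with_proj (mk_symmetric G)) u p u"
    "distinct (tl (pawalk_verts u p))" "p \<noteq> []"
    by (auto simp: pre_digraph.cycle_def awalk_verts_with_proj_eq)
  have verts: "pawalk_verts u' q = u' # map snd q" if "pcas u' q v" for u' q v
    using that by (induction q arbitrary: u') auto
  have chain: "fst (q ! Suc i) = snd (q ! i)" if "pcas u' q v" "Suc i < length q" for u' q v i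
    using that
  proof (induction q arbitrary: u' i)
    case (Cons e q)
    then show ?case by (cases i; cases q) auto
  qed simp
  have last: "snd (last q) = v" if "pcas u' q v" "q \<noteq> []" for u' q v
    using that by (induction q arbitrary: u') auto
  have cas: "pcas u p u" and sub: "set p \<subseteq> parcs (mk_symmetric G)"
    using u(1) by (auto simp: pre_digraph.awalk_def cas_with_proj_eq)
  have "distinct (map snd p)" using u(2) verts[OF cas] by simp
  moreover have "(map snd p ! i, map snd p ! (Suc i mod length p)) \<in> parcs (mk_symmetric G)"
    if i: "i < length p" for i
  proof -
    have lt: "Suc i mod length p < length p" using i by (intro mod_less_divisor) linarith
    have "fst (p ! (Suc i mod length p)) = snd (p ! i)"
    proof (cases "Suc i < length p")
      case True
      then show ?thesis using chain[OF cas] by simp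
    next
      case False
      then have "Suc i = length p" using i by simp
      moreover have "fst (p ! 0) = u" using cas u(3) by (cases p) auto
      moreover have "snd (p ! i) = u"
        using last[OF cas u(3)] \<open>Suc i = length p\<close> u(3) by (metis diff_Suc_1 last_conv_nth)
      ultimately show ?thesis by simp
    qed
    moreover have "p ! (Suc i mod length p) \<in> parcs (mk_symmetric G)"
      using sub lt nth_mem by blast
    ultimately show ?thesis using i lt by (metis nth_map prod.collapse)
  qed
  ultimately show thesis by (intro that[of "map snd p"]) auto
qed

section \<open>Maps whose orbits settle in fixed points\<close>

text \<open>
  The orbit of every point of \<open>S\<close> ends in a fixed point, after at most \<open>N\<close> steps. Hence \<open>f ^^ N\<close> maps
  a point to its limit, and the fibres of \<open>f ^^ N\<close> are the basins of the fixed points.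
\<close>

locale settling_map =
  fixes S :: "'a set" and f :: "'a \<Rightarrow> 'a" and N :: nat
  assumes finite_S: "finite S"
    and closed: "\<And>x. x \<in> S \<Longrightarrow> f x \<in> S"
    and settles: "\<And>x. x \<in> S \<Longrightarrow> f ((f ^^ N) x) = (f ^^ N) x"
begin

definition basin :: "'a \<Rightarrow> 'a set" where
  "basin w = {x \<in> S. (f ^^ N) x = w}"

lemma funpow_closed: "x \<in> S \<Longrightarrow> (f ^^ r) x \<in> S"
  by (induction r) (simp_all add: closed)

lemma limit_step: "x \<in> S \<Longrightarrow> (f ^^ N) (f x) = (f ^^ N) x"
  using settles by (simp add: funpow_swap1)

lemma fixed_in_basin: "w \<in> S \<Longrightarrow> f w = w \<Longrightarrow> w \<in> basin w"
  using funpow_fixed_stable[of f 0 w N] by (simp add: basin_def)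

text \<open>
  Results about settling maps can thus be applied to a single component.
\<close>

lemma settling_basin: "settling_map (basin w) f N"
  by unfold_locales (auto simp: basin_def finite_S closed settles limit_step)

text \<open>
  On a 2-cycle no iterate would be fixed unless the two points coincide.
\<close>

lemma no_two_cycles:
  assumes "x \<in> S" "f (f x) = x"
  shows "f x = x"
proof -
  have "f ((f ^^ r) x) = (f ^^ r) x \<Longrightarrow> f x = x" for r
  proof (induction r)
    case (Suc r)
    have "(f ^^ r) x \<in> {x, f x}"
      by (induction r) (use assms in auto)
    with Suc assms show ?case by auto
  qed simp
  then show ?thesis using settles[OF assms(1)] by blast
qed

definition height :: "'a \<Rightarrow> nat" where
  "height x = (LEAST r. f ((f ^^ r) x) = (f ^^ r) x)"

text \<open>
  This makes \<open>height\<close> the rank function with which \<open>tree_basin\<close> excludes undirected cycles.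
\<close>

lemma height_step:
  assumes "x \<in> S" "f x \<noteq> x"
  shows "height x = Suc (height (f x))"
proof -
  let ?P = "\<lambda>r. f ((f ^^ r) x) = (f ^^ r) x"
  have "(LEAST r. ?P r) = Suc (LEAST r. ?P (Suc r))"
    by (rule Least_Suc[of ?P N]) (use assms settles in auto)
  then show ?thesis by (simp add: height_def funpow_swap1)
qed

lemma connected_remove_loops_basin:
  assumes "w \<in> S" "f w = w"
  shows "Digraph_Component.connected (remove_loops (function_graph (basin w) f))"
proof (rule connected_towards_root[of w _ f])
  show "w \<in> verts (remove_loops (function_graph (basin w) f))"
    using fixed_in_basin[OF assms] by (simp add: remove_loops_def)
next
  fix x assume x: "x \<in> verts (remove_loops (function_graph (basin w) f))"
  then show "\<exists>r. (f ^^ r) x = w" by (auto simp: remove_loops_def basin_def)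
  from x have "f x \<in> basin w"
    by (simp add: remove_loops_def basin_def closed limit_step)
  with x show "f x \<in> verts (remove_loops (function_graph (basin w) f)) \<and>
      (f x = x \<or> (x, f x) \<in> arcs_ends (remove_loops (function_graph (basin w) f)))"
    by (auto simp: remove_loops_def arcs_ends_conv image_iff)
qed

lemma connected_basin:
  assumes "w \<in> S" "f w = w"
  shows "Digraph_Component.connected (function_graph (basin w) f)"
proof (rule connected_towards_root[of w _ f])
  show "w \<in> verts (function_graph (basin w) f)"
    using fixed_in_basin[OF assms] by simp
qed (auto simp: basin_def closed limit_step)

text \<open>
  On an undirected cycle take a vertex of greatest height. Neither of its two neighbours can be
  mapped to it by \<open>f\<close>, as such a neighbour would be higher; so both neighbours are its image under
  \<open>f\<close> and coincide, which is impossible on a cycle of length at least 3.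
\<close>

lemma tree_basin:
  assumes w: "w \<in> S" "f w = w"
  shows "tree_apart_from_loops (function_graph (basin w) f)"
proof -
  let ?G = "remove_loops (function_graph (basin w) f)"
  have "antisym (arcs_ends ?G)"
    by (rule antisymI)
      (auto simp: remove_loops_def arcs_ends_conv basin_def dest: no_two_cycles)
  moreover have "\<not> (pre_digraph.cycle (with_proj (mk_symmetric ?G)) p \<and> length p \<ge> 3)" for p
  proof
    assume p: "pre_digraph.cycle (with_proj (mk_symmetric ?G)) p \<and> length p \<ge> 3"
    then obtain vs where len: "length vs = length p" and dist: "distinct vs"
      and adj: "\<And>i. i < length p \<Longrightarrow> (vs ! i, vs ! (Suc i mod length p)) \<in> parcs (mk_symmetric ?G)"
      using mk_symmetric_cycle_vertices by metis
    let ?n = "length p"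
    obtain i where i: "i < ?n" and top: "\<And>j. j < ?n \<Longrightarrow> height (vs ! j) \<le> height (vs ! i)"
    proof -
      have "Max (height ` set vs) \<in> height ` set vs" using p len by (intro Max_in) auto
      then obtain i where "i < length vs" "height (vs ! i) = Max (height ` set vs)"
        by (metis imageE in_set_conv_nth)
      then show thesis using len by (intro that[of i]) auto
    qed
    have parent: "vs ! j = f (vs ! i)"
      if "j < ?n" "(vs ! i, vs ! j) \<in> parcs (mk_symmetric ?G)" for j
    proof -
      have "vs ! j \<in> S" "vs ! j = f (vs ! i) \<or> f (vs ! j) = vs ! i \<and> f (vs ! j) \<noteq> vs ! j"
        using that(2) by (auto simp: parcs_mk_symmetric remove_loops_def basin_def closed)
      then show ?thesis using height_step[of "vs ! j"] top[OF that(1)] by auto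
    qed
    \<comment> \<open>the two neighbours of position \<open>i\<close>; adding \<open>?n\<close> keeps the natural subtraction exact at \<open>i = 0\<close>\<close>
    define nx where "nx = Suc i mod ?n"
    define pv where "pv = (i + ?n - 1) mod ?n"
    have "?n > 0" using i by linarith
    then have lt: "nx < ?n" "pv < ?n" by (simp_all add: nx_def pv_def)
    have "Suc (i + ?n - 1) = i + ?n" using i by simp
    then have "Suc pv mod ?n = i" using i by (simp add: pv_def mod_Suc_eq)
    then have "(vs ! pv, vs ! i) \<in> parcs (mk_symmetric ?G)" using adj[OF lt(2)] by simp
    then have "(vs ! i, vs ! pv) \<in> parcs (mk_symmetric ?G)"
      by (auto simp: parcs_mk_symmetric)
    then have "vs ! pv = f (vs ! i)" by (rule parent[OF lt(2)])
    moreover have "vs ! nx = f (vs ! i)"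
      using adj[OF i] by (intro parent lt) (simp add: nx_def)
    ultimately have "vs ! pv = vs ! nx" by simp
    then have "pv = nx" using dist len lt by (simp add: nth_eq_iff_index_eq)
    moreover have "nx \<noteq> pv"
    proof (cases "i = 0")
      case True
      have "?n - 1 < ?n" "1 < ?n" using p by linarith+
      with True have "pv = ?n - 1" "nx = 1" by (simp_all add: nx_def pv_def)
      then show ?thesis using p by linarith
    next
      case False
      then have "pv = i - 1" using i by (simp add: pv_def mod_if)
      moreover have "nx = (if Suc i = ?n then 0 else Suc i)" using i by (simp add: nx_def)
      ultimately show ?thesis using p False by auto
    qed
    ultimately show False by simp
  qed
  ultimately show ?thesis
    using connected_remove_loops_basin[OF w]
    by (auto simp: tree_apart_from_loops_def undirected_tree_def)
qed

lemma loop_vertex_basin_iff: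
  assumes "w \<in> S" "f w = w"
  shows "loop_vertex (function_graph (basin w) f) x \<longleftrightarrow> x = w"
  using fixed_in_basin[OF assms] assms funpow_fixed_stable[of f 0 x N]
  by (auto simp: loop_vertex_def basin_def image_iff)

text \<open>
  Both ends of an arc have the same limit, so the limit is constant on a connected subgraph.
\<close>

lemma connected_subgraph_in_basin:
  assumes H: "subgraph H (function_graph S f)" "Digraph_Component.connected H"
    and x: "x \<in> verts H"
  shows "subgraph H (function_graph (basin ((f ^^ N) x)) f)"
proof -
  interpret B: settling_map "basin ((f ^^ N) x)" f N by (rule settling_basin)
  have vS: "verts H \<subseteq> S" and aS: "arcs H \<subseteq> (\<lambda>x. (x, f x)) ` S" and wf: "wf_digraph H"
    and proj: "tail H = fst" "head H = snd"
    using H(1) by (auto simp: subgraph_def compatible_def)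
  have "(f ^^ N) y = (f ^^ N) x" if "y \<in> verts H" for y
  proof -
    have "(x, y) \<in> rtrancl_on (verts H) ((arcs_ends H)\<^sup>s)"
      using H(2) x that by (auto simp: connected_conv)
    then show ?thesis
    proof induction
      case (step y z)
      then have "z = f y \<and> y \<in> S \<or> y = f z \<and> z \<in> S"
        using aS proj by (auto simp: symcl_def arcs_ends_conv)
      then show ?case using step limit_step by auto
    qed simp
  qed
  then have sub: "verts H \<subseteq> basin ((f ^^ N) x)" using vS by (auto simp: basin_def)
  moreover have "arcs H \<subseteq> (\<lambda>x. (x, f x)) ` basin ((f ^^ N) x)"
  proof
    fix e assume e: "e \<in> arcs H"
    then have "fst e \<in> verts H" using wf_digraph.tail_in_verts[OF wf e] proj by simp
    with sub have "fst e \<in> basin ((f ^^ N) x)" by blast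
    moreover have "e = (fst e, f (fst e))" using e aS by auto
    ultimately show "e \<in> (\<lambda>x. (x, f x)) ` basin ((f ^^ N) x)" by blast
  qed
  ultimately show ?thesis
    using wf proj by (auto simp: subgraph_def compatible_def intro: wf_function_graph B.closed)
qed

lemma subgraph_basin: "subgraph (function_graph (basin w) f) (function_graph S f)"
proof -
  interpret B: settling_map "basin w" f N by (rule settling_basin)
  show ?thesis
    using closed B.closed
    by (auto simp: subgraph_def compatible_def basin_def intro!: wf_function_graph)
qed

text \<open>
  A basin is connected because all its vertices flow to its fixed point, and by
  \<open>connected_subgraph_in_basin\<close> every connected subgraph lies in a basin; so the basins are exactly
  the maximal connected subgraphs.
\<close>

lemma weak_components_function_graph:
  "weak_components (function_graph S f) = (\<lambda>w. function_graph (basin w) f) ` {w \<in> S. f w = w}"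
proof (intro equalityI subsetI)
  fix C assume "C \<in> weak_components (function_graph S f)"
  then have C: "subgraph C (function_graph S f)" "Digraph_Component.connected C"
    and maxi: "\<And>H. H \<noteq> C \<Longrightarrow> subgraph C H \<Longrightarrow>
      \<not> (subgraph H (function_graph S f) \<and> Digraph_Component.connected H)"
    by (auto simp: weak_components_def pre_digraph.max_subgraph_def)
  from C(2) obtain x where x: "x \<in> verts C" by (auto simp: connected_conv)
  then have "x \<in> S" using C(1) by (auto simp: subgraph_def)
  define w where "w = (f ^^ N) x"
  have w: "w \<in> S" "f w = w" using \<open>x \<in> S\<close> funpow_closed settles by (auto simp: w_def)
  have "C = function_graph (basin w) f"
    using maxi[of "function_graph (basin w) f"] connected_subgraph_in_basin[OF C x]
      subgraph_basin connected_basin[OF w] by (auto simp: w_def)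
  with w show "C \<in> (\<lambda>w. function_graph (basin w) f) ` {w \<in> S. f w = w}" by auto
next
  fix C assume "C \<in> (\<lambda>w. function_graph (basin w) f) ` {w \<in> S. f w = w}"
  then obtain w where w: "w \<in> S" "f w = w" and C: "C = function_graph (basin w) f" by auto
  have "H = C"
    if H: "subgraph C H" "subgraph H (function_graph S f)" "Digraph_Component.connected H" for H
  proof -
    have "w \<in> verts H" using H(1) fixed_in_basin[OF w] by (auto simp: subgraph_def C)
    moreover have "(f ^^ N) w = w" using fixed_in_basin[OF w] by (simp add: basin_def)
    ultimately have "subgraph H C"
      using connected_subgraph_in_basin[OF H(2,3)] unfolding C by metis
    with H(1) show ?thesis using subgraph_antisymmetric by blast
  qed
  then show "C \<in> weak_components (function_graph S f)"
    using subgraph_basin connected_basin[OF w]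
    by (auto simp: weak_components_def pre_digraph.max_subgraph_def C)
qed

lemma same_component_iff:
  assumes "x \<in> S" "y \<in> S"
  shows "(\<exists>C \<in> weak_components (function_graph S f). x \<in> verts C \<and> y \<in> verts C) \<longleftrightarrow>
    (f ^^ N) x = (f ^^ N) y"
  using assms settles funpow_closed by (auto simp: weak_components_function_graph basin_def)

lemma card_weak_components:
  "card (weak_components (function_graph S f)) = card {w \<in> S. f w = w}"
  unfolding weak_components_function_graph
proof (rule card_image, rule inj_onI)
  fix w w'
  assume w: "w \<in> {w \<in> S. f w = w}" "w' \<in> {w \<in> S. f w = w}"
    and eq: "function_graph (basin w) f = function_graph (basin w') f"
  have "w \<in> basin w" using fixed_in_basin w by simp
  also have "basin w = basin w'" using arg_cong[OF eq, of verts] by simp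
  finally show "w = w'" using fixed_in_basin[of w] w by (simp add: basin_def)
qed

text \<open>
  A repetition among the first \<open>N + 1\<close> points of an orbit would let the orbit reach its limit before
  time \<open>N\<close>.
\<close>

lemma orbit_distinct:
  assumes x: "x \<in> S" and late: "\<And>r. r < N \<Longrightarrow> f ((f ^^ r) x) \<noteq> (f ^^ r) x"
  shows "inj_on (\<lambda>r. (f ^^ r) x) {..N}"
proof -
  have "(f ^^ i) x \<noteq> (f ^^ j) x" if "i < j" "j \<le> N" for i j
  proof
    assume eq: "(f ^^ i) x = (f ^^ j) x"
    let ?r = "(N - j) + i"
    have "(f ^^ ?r) x = (f ^^ (N - j)) ((f ^^ j) x)" by (simp add: funpow_add eq)
    also have "\<dots> = (f ^^ (N - j + j)) x" by (simp only: funpow_add comp_apply)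
    also have "\<dots> = (f ^^ N) x" using that by simp
    finally have "f ((f ^^ ?r) x) = (f ^^ ?r) x" using settles[OF x] by simp
    with late[of ?r] that show False by simp
  qed
  then show ?thesis by (intro linorder_inj_onI) auto
qed

lemma orbit_eq_image:
  assumes "x \<in> S"
  shows "{(f ^^ r) x | r. True} = (\<lambda>r. (f ^^ r) x) ` {..N}"
proof -
  have "(f ^^ r) x \<in> (\<lambda>r. (f ^^ r) x) ` {..N}" for r
    using funpow_fixed_stable[OF settles[OF assms], of r] by (cases "r \<le> N") auto
  then show ?thesis by auto
qed

text \<open>
  A directed path follows an orbit, which is constant from time \<open>N\<close> on, so it has at most \<open>N + 1\<close>
  vertices; a point that is not settled before time \<open>N\<close> starts a path with exactly that many.
\<close>

lemma depth_function_graph: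
  assumes x: "x \<in> S" and late: "\<And>r. r < N \<Longrightarrow> f ((f ^^ r) x) \<noteq> (f ^^ r) x"
  shows "depth (function_graph S f) = Suc N"
proof -
  let ?L = "{length p | p. vpath p (function_graph S f)}"
  have bound: "length p \<le> Suc N" if p: "vpath p (function_graph S f)" for p
  proof (rule ccontr)
    assume long: "\<not> length p \<le> Suc N"
    have step: "p ! Suc i = f (p ! i)" if "Suc i < length p" for i
      using p successively_nth[OF _ that] by (fastforce simp: vpath_iff)
    have nth: "p ! i = (f ^^ i) (p ! 0)" if "i < length p" for i
      using that by (induction i) (auto simp: step)
    have "p ! 0 \<in> S" using p long by (auto simp: vpath_iff)
    then have "p ! Suc N = p ! N" using nth long settles by simp
    moreover have "distinct p" using p by (simp add: vpath_iff)
    ultimately show False using long by (simp add: nth_eq_iff_index_eq)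
  qed
  let ?q = "map (\<lambda>r. (f ^^ r) x) [0..<Suc N]"
  have "distinct ?q"
    using orbit_distinct[OF assms] by (simp add: distinct_map lessThan_Suc_atMost atLeast0LessThan del: upt_Suc)
  moreover have "successively (\<lambda>x y. (x, y) \<in> arcs_ends (function_graph S f)) ?q"
    using funpow_closed[OF x] by (auto simp: successively_conv_nth simp del: upt_Suc)
  ultimately have "vpath ?q (function_graph S f)"
    using funpow_closed[OF x] by (auto simp: vpath_iff simp del: upt_Suc)
  then have "length ?q \<in> ?L" by blast
  then have "Suc N \<in> ?L" by simp
  moreover have "finite ?L" by (rule finite_subset[of _ "{..Suc N}"]) (auto dest: bound)
  ultimately show ?thesis unfolding depth_def by (intro Max_eqI) (auto dest: bound)
qed

end

section \<open>Propagation of signs\<close>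

text \<open>
  On a finite type the potential \<open>M\<close> cannot increase forever, so every orbit becomes constant. The
  least time at which all orbits have done so is attained by one of them.
\<close>

lemma exists_settling_time:
  fixes h :: "'n::finite \<Rightarrow> 'n" and M :: "'n \<Rightarrow> real"
  assumes incr: "\<And>l. h l \<noteq> l \<Longrightarrow> M l < M (h l)"
  shows "\<exists>K. (\<forall>l. h ((h ^^ K) l) = (h ^^ K) l) \<and> (\<exists>l. \<forall>r<K. h ((h ^^ r) l) \<noteq> (h ^^ r) l)"
proof -
  have "\<exists>r. h ((h ^^ r) l) = (h ^^ r) l" for l
  proof (rule ccontr)
    assume "\<nexists>r. h ((h ^^ r) l) = (h ^^ r) l"
    then have "strict_mono (\<lambda>r. M ((h ^^ r) l))"
      using incr by (simp add: strict_mono_Suc_iff)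
    then have "inj (\<lambda>r. (h ^^ r) l)"
      by (intro injI) (metis strict_mono_eq)
    then show False using finite_imageD[of "\<lambda>r. (h ^^ r) l" UNIV] by simp
  qed
  then obtain \<rho> where \<rho>: "\<And>l. h ((h ^^ \<rho> l) l) = (h ^^ \<rho> l) l" by metis
  let ?P = "\<lambda>K. \<forall>l. h ((h ^^ K) l) = (h ^^ K) l"
  have "?P (Max (range \<rho>))"
    using \<rho> funpow_fixed_stable[OF \<rho>, of _ "Max (range \<rho>)"] by simp
  then obtain K where K: "?P K" and least: "\<And>r. r < K \<Longrightarrow> \<not> ?P r"
    using exists_least_iff[of ?P] by blast
  have "\<exists>l. \<forall>r<K. h ((h ^^ r) l) \<noteq> (h ^^ r) l"
  proof (cases K)
    case (Suc k)
    then obtain l where l: "h ((h ^^ k) l) \<noteq> (h ^^ k) l" using least[of k] by auto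
    have "h ((h ^^ r) l) \<noteq> (h ^^ r) l" if "r < K" for r
      using l funpow_fixed_stable[of h r l k] that Suc by auto
    then show ?thesis by blast
  qed simp
  with K show ?thesis by blast
qed

text \<open>
  A sign vector is determined by the set of positions at which it differs from \<open>w\<close>; here this may be
  any subset of the complement of \<open>E\<close>.
\<close>

lemma card_sign_vecs_agreeing:
  fixes w :: "real ^ 'n" and E :: "'n set"
  assumes w: "w \<in> sign_vecs"
  shows "finite {t \<in> sign_vecs. \<forall>j\<in>E. t $ j = w $ j}"
    and "card {t \<in> sign_vecs. \<forall>j\<in>E. t $ j = w $ j} = 2 ^ (CARD('n) - card E)"
proof -
  let ?X = "{t \<in> sign_vecs. \<forall>j\<in>E. t $ j = w $ j}"
  have wz: "w $ j \<noteq> - w $ j" for j using sign_vecs_nth[OF w, of j] by auto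
  have flip: "t $ j = - w $ j" if "t \<in> sign_vecs" "t $ j \<noteq> w $ j" for t j
    using sign_vecs_nth[OF w, of j] sign_vecs_nth[OF that(1), of j] that(2) by auto
  have "bij_betw (\<lambda>t. {j. t $ j \<noteq> w $ j}) ?X (Pow (- E))"
  proof (rule bij_betw_byWitness[where f' = "\<lambda>B. \<chi> j. if j \<in> B then - w $ j else w $ j"])
    show "\<forall>t\<in>?X. (\<chi> j. if j \<in> {j. t $ j \<noteq> w $ j} then - w $ j else w $ j) = t"
      using flip by (auto simp: vec_eq_iff)
    show "\<forall>B\<in>Pow (- E). {j. (\<chi> j. if j \<in> B then - w $ j else w $ j) $ j \<noteq> w $ j} = B"
      using wz by auto
    show "(\<lambda>B. \<chi> j. if j \<in> B then - w $ j else w $ j) ` Pow (- E) \<subseteq> ?X"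
      using w by (fastforce simp: sign_vecs_def)
  qed auto
  then show "finite ?X" "card ?X = 2 ^ (CARD('n) - card E)"
    by (simp_all add: bij_betw_finite bij_betw_same_card card_Pow Compl_eq_Diff_UNIV card_Diff_subset)
qed

text \<open>
  The rule of \<open>V_map_nth\<close> together with the dynamics of its index map \<open>h\<close>: \<open>K\<close> is the exact time
  that \<open>h\<close> needs to settle. The dynamics of \<open>V\<close> follows from that of \<open>h\<close>, because the \<open>r\<close>-th iterate
  of \<open>V\<close> at \<open>l\<close> is, up to sign, the original vector at \<open>(h ^^ r) l\<close>.
\<close>

locale sign_propagation =
  fixes V :: "real ^ 'n \<Rightarrow> real ^ 'n" and h :: "'n \<Rightarrow> 'n" and c :: "'n \<Rightarrow> real" and K :: nat
  assumes V_nth: "\<And>t l. t \<in> sign_vecs \<Longrightarrow> V t $ l = c l * t $ h l"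
    and c_cases: "\<And>l. c l \<in> {-1, 1}"
    and c_fixed: "\<And>l. h l = l \<Longrightarrow> c l = 1"
    and h_settles: "\<And>l. h ((h ^^ K) l) = (h ^^ K) l"
    and h_late: "\<exists>l. \<forall>r<K. h ((h ^^ r) l) \<noteq> (h ^^ r) l"
begin

definition F :: "'n set" where "F = {j. h j = j}"

lemma c_nonzero: "c l \<noteq> 0"
  using c_cases[of l] by auto

lemma V_closed:
  assumes "t \<in> sign_vecs"
  shows "V t \<in> sign_vecs"
proof -
  have "V t $ l \<in> {-1, 1}" for l
    using V_nth[OF assms, of l] c_cases[of l] sign_vecs_nth[OF assms, of "h l"] by auto
  then show ?thesis by (simp add: sign_vecs_def)
qed

lemma funpow_V_closed: "t \<in> sign_vecs \<Longrightarrow> (V ^^ r) t \<in> sign_vecs"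
  by (induction r) (simp_all add: V_closed)

lemma funpow_V_nth:
  assumes "t \<in> sign_vecs"
  shows "(V ^^ r) t $ l = (\<Prod>s<r. c ((h ^^ s) l)) * t $ (h ^^ r) l"
proof (induction r arbitrary: l)
  case (Suc r)
  have "(V ^^ Suc r) t $ l = c l * ((\<Prod>s<r. c ((h ^^ s) (h l))) * t $ (h ^^ r) (h l))"
    using funpow_V_closed[OF assms] by (simp add: V_nth Suc.IH)
  then show ?case by (simp add: prod.lessThan_Suc_shift funpow_swap1 del: prod.lessThan_Suc)
qed simp

text \<open>
  After \<open>K\<close> steps each index has reached a fixed point of \<open>h\<close>, where the factor \<open>c\<close> is \<open>1\<close>.
\<close>

lemma V_settles:
  assumes "t \<in> sign_vecs"
  shows "V ((V ^^ K) t) = (V ^^ K) t"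
proof -
  have "(V ^^ Suc K) t $ l = (V ^^ K) t $ l" for l
    unfolding funpow_V_nth[OF assms] by (simp add: h_settles c_fixed)
  then show ?thesis by (simp add: vec_eq_iff)
qed

sublocale settling_map sign_vecs V K
proof
  have "(\<chi> i. 1) \<in> (sign_vecs :: (real ^ 'n) set)" by (simp add: sign_vecs_def)
  from card_sign_vecs_agreeing(1)[OF this, of "{}"]
  show "finite (sign_vecs :: (real ^ 'n) set)" by simp
qed (auto intro: V_closed V_settles)

lemma limit_on_F:
  assumes "t \<in> sign_vecs" "j \<in> F"
  shows "(V ^^ K) t $ j = t $ j"
proof -
  have "(h ^^ s) j = j" for s
    using funpow_fixed_stable[of h 0 j s] assms(2) by (simp add: F_def)
  then show ?thesis using assms by (simp add: funpow_V_nth F_def c_fixed)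
qed

text \<open>
  The limit of \<open>t\<close> at \<open>l\<close> depends only on the sign of \<open>t\<close> at \<open>(h ^^ K) l\<close>, which lies in \<open>F\<close>;
  conversely the signs on \<open>F\<close> never change.
\<close>

lemma limit_eq_iff:
  assumes "t \<in> sign_vecs" "u \<in> sign_vecs"
  shows "(V ^^ K) t = (V ^^ K) u \<longleftrightarrow> (\<forall>j\<in>F. t $ j = u $ j)"
proof
  assume "\<forall>j\<in>F. t $ j = u $ j"
  moreover have "(h ^^ K) l \<in> F" for l by (simp add: F_def h_settles)
  ultimately show "(V ^^ K) t = (V ^^ K) u"
    using assms by (simp add: vec_eq_iff funpow_V_nth)
qed (metis limit_on_F assms)

lemma funpow_V_fixed: "V w = w \<Longrightarrow> (V ^^ r) w = w"
  using funpow_fixed_stable[of V 0 w r] by simp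

lemma basin_eq:
  assumes "w \<in> sign_vecs" "V w = w"
  shows "basin w = {t \<in> sign_vecs. \<forall>j\<in>F. t $ j = w $ j}"
  unfolding basin_def
  using limit_eq_iff[OF _ assms(1)] funpow_V_fixed[OF assms(2)] by auto

lemma card_basin:
  assumes "w \<in> sign_vecs" "V w = w"
  shows "card (basin w) = 2 ^ (CARD('n) - card F)"
  using card_sign_vecs_agreeing(2)[OF assms(1)] by (simp add: basin_eq[OF assms])

text \<open>
  The basins of the fixed points partition the \<open>2 ^ CARD('n)\<close> sign vectors and all have the same
  size.
\<close>

lemma card_fixed: "card {w \<in> sign_vecs. V w = w} = 2 ^ card F"
proof -
  let ?W = "{w \<in> sign_vecs. V w = w}"
  have "(\<chi> i. 1) \<in> (sign_vecs :: (real ^ 'n) set)" by (simp add: sign_vecs_def)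
  then have total: "card (sign_vecs :: (real ^ 'n) set) = 2 ^ CARD('n)"
    using card_sign_vecs_agreeing(2)[of "\<chi> i. 1" "{}"] by simp
  have inj: "inj_on basin ?W"
    by (rule inj_onI) (metis (mono_tags, lifting) basin_def fixed_in_basin funpow_V_fixed mem_Collect_eq)
  have union: "\<Union> (basin ` ?W) = sign_vecs"
    using V_settles funpow_V_closed by (auto simp: basin_def)
  have "2 ^ (CARD('n) - card F) * card (basin ` ?W) = card (\<Union> (basin ` ?W))"
  proof (rule card_partition)
    show "finite (\<Union> (basin ` ?W))" "finite (basin ` ?W)"
      unfolding union using finite_S by auto
    show "card B = 2 ^ (CARD('n) - card F)" if "B \<in> basin ` ?W" for B
      using that card_basin by auto
    show "B \<inter> B' = {}" if "B \<in> basin ` ?W" "B' \<in> basin ` ?W" "B \<noteq> B'" for B B'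
      using that by (auto simp: basin_def)
  qed
  then have "2 ^ (CARD('n) - card F) * card ?W = (2::nat) ^ CARD('n)"
    by (simp add: union total card_image[OF inj])
  also have "\<dots> = 2 ^ (CARD('n) - card F) * 2 ^ card F"
    using card_mono[of UNIV F] by (simp flip: power_add)
  finally show ?thesis by simp
qed

text \<open>
  On sign vectors this is the function \<open>d\<close>, with the limit written as an iterate of \<open>V\<close>.
\<close>

definition deviation :: "real ^ 'n \<Rightarrow> real ^ 'n" where
  "deviation t = (\<chi> i. t $ i / (V ^^ K) t $ i)"

text \<open>
  For a sign vector \<open>t\<close> and a fixed point \<open>w\<close>: the vector in the basin of \<open>w\<close> that has the same
  deviation as \<open>t\<close>.
\<close>

definition transport :: "real ^ 'n \<Rightarrow> real ^ 'n \<Rightarrow> real ^ 'n" where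
  "transport w t = (\<chi> i. deviation t $ i * w $ i)"

lemma nonzero: "t \<in> sign_vecs \<Longrightarrow> t $ i \<noteq> 0"
  using sign_vecs_nth[of t i] by auto

text \<open>
  A vector and its limit receive the same factor \<open>c l\<close>, which cancels in their quotient. The
  evolution of deviations therefore does not depend on the basin; this is why all components are
  isomorphic.
\<close>

lemma deviation_step:
  assumes t: "t \<in> sign_vecs"
  shows "deviation (V t) $ l = deviation t $ h l"
proof -
  let ?w = "(V ^^ K) t"
  have "?w $ l = c l * ?w $ h l"
    using V_nth[OF funpow_V_closed[OF t], of K l] V_settles[OF t] by simp
  then show ?thesis
    using c_nonzero by (simp add: deviation_def limit_step[OF t] V_nth[OF t])
qed

lemma transport_in_basin:
  assumes t: "t \<in> sign_vecs" and w: "w \<in> sign_vecs" "V w = w"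
  shows "transport w t \<in> basin w"
proof -
  have "transport w t $ i \<in> {-1, 1}" for i
    using sign_vecs_nth[OF t, of i] sign_vecs_nth[OF w(1), of i]
      sign_vecs_nth[OF funpow_V_closed[OF t, of K], of i]
    by (auto simp: transport_def deviation_def)
  moreover have "transport w t $ j = w $ j" if "j \<in> F" for j
    using limit_on_F[OF t that] nonzero[OF t] by (simp add: transport_def deviation_def)
  moreover from calculation(1) have "transport w t \<in> sign_vecs" by (simp add: sign_vecs_def)
  ultimately show ?thesis by (simp add: basin_eq[OF w])
qed

lemma deviation_transport:
  assumes t: "t \<in> sign_vecs" and w: "w \<in> sign_vecs" "V w = w"
  shows "deviation (transport w t) = deviation t"
  using transport_in_basin[OF assms] nonzero[OF w(1)]
  by (simp add: vec_eq_iff deviation_def[of "transport w t"] basin_def)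
    (simp add: transport_def)

lemma transport_unique:
  assumes w: "w \<in> sign_vecs" and u: "u \<in> basin w" and eq: "deviation u = deviation t"
  shows "u = transport w t"
  unfolding transport_def eq[symmetric]
  using u nonzero[OF w] by (simp add: vec_eq_iff deviation_def basin_def)

lemma transport_step:
  assumes t: "t \<in> sign_vecs" and w: "w \<in> sign_vecs" "V w = w"
  shows "transport w (V t) = V (transport w t)"
proof -
  have tr: "transport w t \<in> sign_vecs"
    using transport_in_basin[OF assms] by (simp add: basin_def)
  have "transport w (V t) $ l = V (transport w t) $ l" for l
  proof -
    have "transport w (V t) $ l = deviation t $ h l * w $ l"
      by (simp add: transport_def deviation_step[OF t])
    also have "w $ l = c l * w $ h l" using V_nth[OF w(1), of l] w(2) by simp
    also have "deviation t $ h l * (c l * w $ h l) = c l * transport w t $ h l"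
      by (simp add: transport_def)
    finally show ?thesis by (simp only: V_nth[OF tr])
  qed
  then show ?thesis by (simp add: vec_eq_iff)
qed

lemma transport_isomorphism:
  assumes w1: "w1 \<in> sign_vecs" "V w1 = w1" and w2: "w2 \<in> sign_vecs" "V w2 = w2"
    and g: "\<And>t. t \<in> basin w1 \<Longrightarrow> g t \<in> basin w2"
    and dev: "\<And>t. t \<in> basin w1 \<Longrightarrow> deviation (g t) = deviation t"
  shows "isomorphism_via g (function_graph (basin w1) V) (function_graph (basin w2) V)"
proof (rule isomorphism_via_function_graph)
  interpret B: settling_map "basin w1" V K by (rule settling_basin)
  have basinD: "t \<in> sign_vecs" if "t \<in> basin w" for t w using that by (simp add: basin_def)
  have g_eq: "g t = transport w2 t" if "t \<in> basin w1" for t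
    using transport_unique[OF w2(1) g dev] that by blast
  show closed1: "V t \<in> basin w1" if "t \<in> basin w1" for t by (rule B.closed[OF that])
  show "g (V t) = V (g t)" if "t \<in> basin w1" for t
    using that closed1 by (simp add: g_eq transport_step[OF basinD w2])
  show "bij_betw g (basin w1) (basin w2)"
  proof (rule bij_betw_byWitness[where f' = "transport w1"])
    show "\<forall>t\<in>basin w1. transport w1 (g t) = t"
      using transport_unique[OF w1(1)] dev by metis
    show "\<forall>u\<in>basin w2. g (transport w1 u) = u"
      using transport_unique[OF w2(1)] transport_in_basin[OF basinD w1]
        deviation_transport[OF basinD w1] g_eq by metis
    show "transport w1 ` basin w2 \<subseteq> basin w1"
      using transport_in_basin[OF basinD w1] by blast
  qed (use g in blast)
qed

text \<open>
  The vector that differs from \<open>w\<close> at every position outside \<open>F\<close> takes the full time \<open>K\<close>: it has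
  reached its limit \<open>w\<close> at time \<open>r\<close> only if \<open>(h ^^ r) l\<close> lies in \<open>F\<close> for every \<open>l\<close>.
\<close>

lemma late_vertex_in_basin:
  assumes w: "w \<in> sign_vecs" "V w = w"
  obtains t where "t \<in> basin w" "\<And>r. r < K \<Longrightarrow> V ((V ^^ r) t) \<noteq> (V ^^ r) t"
proof
  define t where "t = (\<chi> j. if j \<in> F then w $ j else - w $ j)"
  have t: "t \<in> sign_vecs"
    using sign_vecs_nth[OF w(1)] by (fastforce simp: t_def sign_vecs_def)
  then show tw: "t \<in> basin w" by (simp add: basin_eq[OF w] t_def)
  obtain l where l: "\<And>r. r < K \<Longrightarrow> h ((h ^^ r) l) \<noteq> (h ^^ r) l" using h_late by blast
  show "V ((V ^^ r) t) \<noteq> (V ^^ r) t" if "r < K" for r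
  proof
    assume "V ((V ^^ r) t) = (V ^^ r) t"
    then have "(V ^^ K) t = (V ^^ r) t" using that by (intro funpow_fixed_stable) auto
    then have "(V ^^ r) t = (V ^^ r) w" using tw funpow_V_fixed[OF w(2)] by (simp add: basin_def)
    then have "(V ^^ r) t $ l = (V ^^ r) w $ l" by simp
    moreover have "(\<Prod>s<r. c ((h ^^ s) l)) \<noteq> 0" using c_nonzero by simp
    ultimately have "t $ (h ^^ r) l = w $ (h ^^ r) l" by (simp add: funpow_V_nth t w(1))
    with l[OF that] nonzero[OF w(1), of "(h ^^ r) l"] show False
      by (simp add: t_def F_def)
  qed
qed

lemma depth_basin:
  assumes w: "w \<in> sign_vecs" "V w = w"
  shows "depth (function_graph (basin w) V) = Suc K"
  using late_vertex_in_basin[OF w] settling_map.depth_function_graph[OF settling_basin]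
  by metis

lemma depth_transition: "depth (function_graph sign_vecs V) = Suc K"
proof -
  have "(\<chi> i. 1) \<in> (sign_vecs :: (real ^ 'n) set)" by (simp add: sign_vecs_def)
  then have "(V ^^ K) (\<chi> i. 1) \<in> sign_vecs" "V ((V ^^ K) (\<chi> i. 1)) = (V ^^ K) (\<chi> i. 1)"
    by (auto intro: funpow_V_closed V_settles)
  then obtain t where "t \<in> sign_vecs" "\<And>r. r < K \<Longrightarrow> V ((V ^^ r) t) \<noteq> (V ^^ r) t"
    using late_vertex_in_basin unfolding basin_def by blast
  then show ?thesis by (rule depth_function_graph)
qed

end

section \<open>The structure of the sign transition graph\<close>

theorem theorem4p2:
  fixes A :: "real ^ 'n ^ 'm" and F :: "'n set" and k :: nat
  assumes "CARD('m) \<ge> 2" and "CARD('n) \<ge> 2"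
    and "preserves_Chebyshev A"
    and "F = {j. jpos A (ipos A j) = j}"
    and "k = card F"
  shows
    "(\<forall>t1 \<in> sign_vecs. \<forall>t2 \<in> sign_vecs.
        (\<exists>C \<in> weak_components (sign_transition_graph A). t1 \<in> verts C \<and> t2 \<in> verts C)
        \<longleftrightarrow> (\<forall>j \<in> F. t1 $ j = t2 $ j)) \<and>

     (\<forall>C \<in> weak_components (sign_transition_graph A).
        card (verts C) = 2 ^ (CARD('n) - k) \<and>
        tree_apart_from_loops C \<and>
        (\<exists>!t. loop_vertex C t)) \<and>
     card (weak_components (sign_transition_graph A)) = 2 ^ k \<and>

     (\<forall>C1 \<in> weak_components (sign_transition_graph A).
      \<forall>C2 \<in> weak_components (sign_transition_graph A).
        digraph_iso C1 C2 \<and>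
        (\<forall>t1 \<in> verts C1. \<exists>!t2. t2 \<in> verts C2 \<and> d_map A t2 = d_map A t1) \<and>
        (\<exists>!g. g \<in> verts C1 \<rightarrow>\<^sub>E verts C2 \<and> (\<forall>t \<in> verts C1. d_map A (g t) = d_map A t)) \<and>
        (\<forall>g. g \<in> verts C1 \<rightarrow> verts C2 \<and> (\<forall>t \<in> verts C1. d_map A (g t) = d_map A t)
           \<longrightarrow> isomorphism_via g C1 C2)) \<and>

     (\<forall>C \<in> weak_components (sign_transition_graph A).
        depth (sign_transition_graph A) = depth C) \<and>
     depth (sign_transition_graph A) = depth (sign_dependency_graph A) \<and>
     depth (sign_dependency_graph A) =
       Max (range (\<lambda>j. card (visited_columns (mat_abs A) j)))"
proof -
  note A = assms(3)
  define h where "h = column_successor A"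
  \<comment> \<open>with the column maximum as potential, \<open>K\<close> is the least number of steps after which every
    column walk rests\<close>
  obtain K where settles: "\<And>l. h ((h ^^ K) l) = (h ^^ K) l"
    and late: "\<exists>l. \<forall>r<K. h ((h ^^ r) l) \<noteq> (h ^^ r) l"
    using exists_settling_time[of h "\<lambda>l. \<bar>A $ ipos A l $ l\<bar>"] column_max_increases[OF A]
    unfolding h_def by blast
  interpret SP: sign_propagation "V_map A" h "transfer_sign A" K
  proof (rule sign_propagation.intro)
    show "V_map A t $ l = transfer_sign A l * t $ h l" if "t \<in> sign_vecs" for t l
      unfolding h_def by (rule V_map_nth[OF A that])
    show "transfer_sign A l = 1" if "h l = l" for l
      using transfer_sign_fixed[OF A] that by (simp add: h_def)
  qed (rule transfer_sign_cases[OF A] settles late)+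
  interpret D: settling_map UNIV h K
    by (rule settling_map.intro) (simp_all add: settles)
  have "SP.F = {j. h j = j}" by (rule SP.F_def)
  then have F: "SP.F = F" by (simp add: h_def column_successor_def assms(4))
  have G: "sign_transition_graph A = function_graph sign_vecs (V_map A)"
    unfolding sign_transition_graph_def function_graph_def
    using SP.V_closed by (intro arg_cong[of _ _ with_proj]) auto
  let ?W = "{w \<in> sign_vecs. V_map A w = w}"
  let ?C = "\<lambda>w. function_graph (SP.basin w) (V_map A)"
  have comps: "weak_components (sign_transition_graph A) = ?C ` ?W"
    unfolding G by (rule SP.weak_components_function_graph)

  have "eventual A t = (V_map A ^^ K) t" if "t \<in> sign_vecs" for t
    unfolding eventual_def
  proof (rule the_equality)
    have "(V_map A ^^ r) t = (V_map A ^^ K) t" if "K \<le> r" for r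
      using SP.V_settles[OF \<open>t \<in> sign_vecs\<close>] that by (rule funpow_fixed_stable)
    then show ev: "\<forall>\<^sub>F r in sequentially. (V_map A ^^ r) t = (V_map A ^^ K) t"
      unfolding eventually_sequentially by blast
    show "w = (V_map A ^^ K) t" if "\<forall>\<^sub>F r in sequentially. (V_map A ^^ r) t = w" for w
      using eventually_happens[OF eventually_conj[OF that ev]] by auto
  qed
  then have d: "d_map A t = SP.deviation t" if "t \<in> sign_vecs" for t
    using that by (simp add: d_map_def SP.deviation_def)
  have basinD: "t \<in> sign_vecs" if "t \<in> SP.basin w" for t w using that by (simp add: SP.basin_def)

  have same: "(\<exists>C \<in> weak_components (sign_transition_graph A). t1 \<in> verts C \<and> t2 \<in> verts C)
      \<longleftrightarrow> (\<forall>j \<in> F. t1 $ j = t2 $ j)" if "t1 \<in> sign_vecs" "t2 \<in> sign_vecs" for t1 t2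
    unfolding G using SP.same_component_iff[OF that] SP.limit_eq_iff[OF that] F by simp

  have shape: "card (verts C) = 2 ^ (CARD('n) - k) \<and> tree_apart_from_loops C \<and> (\<exists>!t. loop_vertex C t)"
    if "C \<in> weak_components (sign_transition_graph A)" for C
    using that SP.card_basin SP.tree_basin SP.loop_vertex_basin_iff
    by (auto simp: comps F assms(5))

  have number: "card (weak_components (sign_transition_graph A)) = 2 ^ k"
    unfolding G by (simp add: SP.card_weak_components SP.card_fixed F assms(5))

  have iso: "digraph_iso C1 C2 \<and>
        (\<forall>t1 \<in> verts C1. \<exists>!t2. t2 \<in> verts C2 \<and> d_map A t2 = d_map A t1) \<and>
        (\<exists>!g. g \<in> verts C1 \<rightarrow>\<^sub>E verts C2 \<and> (\<forall>t \<in> verts C1. d_map A (g t) = d_map A t)) \<and>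
        (\<forall>g. g \<in> verts C1 \<rightarrow> verts C2 \<and> (\<forall>t \<in> verts C1. d_map A (g t) = d_map A t)
           \<longrightarrow> isomorphism_via g C1 C2)"
    if C12: "C1 \<in> weak_components (sign_transition_graph A)"
      "C2 \<in> weak_components (sign_transition_graph A)" for C1 C2
  proof -
    obtain w1 w2 where w1: "w1 \<in> sign_vecs" "V_map A w1 = w1" and C1: "C1 = ?C w1"
      and w2: "w2 \<in> sign_vecs" "V_map A w2 = w2" and C2: "C2 = ?C w2"
      using C12 by (auto simp: comps)
    have verts: "verts C1 = SP.basin w1" "verts C2 = SP.basin w2" by (simp_all add: C1 C2)
    let ?tr = "SP.transport w2"
    have d_basin: "d_map A t = SP.deviation t" if "t \<in> SP.basin w" for t w
      by (rule d[OF basinD[OF that]])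
    have tr: "?tr t \<in> SP.basin w2" if "t \<in> SP.basin w1" for t
      by (rule SP.transport_in_basin[OF basinD[OF that] w2])
    have d_tr: "d_map A (?tr t) = d_map A t" if "t \<in> SP.basin w1" for t
      using SP.deviation_transport[OF basinD[OF that] w2] d_basin[OF that] d_basin[OF tr[OF that]]
      by simp
    have tr_unique: "u = ?tr t"
      if "t \<in> SP.basin w1" "u \<in> SP.basin w2" "d_map A u = d_map A t" for t u
      using that by (intro SP.transport_unique[OF w2(1)]) (simp_all add: d_basin)
    have via: "isomorphism_via g C1 C2"
      if g: "g \<in> SP.basin w1 \<rightarrow> SP.basin w2"
        and dg: "\<forall>t \<in> SP.basin w1. d_map A (g t) = d_map A t" for g
      unfolding C1 C2
    proof (rule SP.transport_isomorphism[OF w1 w2])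
      fix t assume t: "t \<in> SP.basin w1"
      show gt: "g t \<in> SP.basin w2" using g t by blast
      show "SP.deviation (g t) = SP.deviation t"
        using dg t d_basin[OF gt] d_basin[OF t] by simp
    qed
    have "isomorphism_via ?tr C1 C2" using tr d_tr by (intro via) blast+
    then have "digraph_iso C1 C2" unfolding isomorphism_via_def digraph_iso_def by blast
    moreover have "\<forall>t1 \<in> verts C1. \<exists>!t2. t2 \<in> verts C2 \<and> d_map A t2 = d_map A t1"
    proof
      fix t1 assume "t1 \<in> verts C1"
      then have t1: "t1 \<in> SP.basin w1" by (simp add: verts)
      show "\<exists>!t2. t2 \<in> verts C2 \<and> d_map A t2 = d_map A t1"
        unfolding verts
      proof (rule ex1I[of _ "?tr t1"])
        show "?tr t1 \<in> SP.basin w2 \<and> d_map A (?tr t1) = d_map A t1" using tr d_tr t1 by blast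
        show "t2 = ?tr t1" if "t2 \<in> SP.basin w2 \<and> d_map A t2 = d_map A t1" for t2
          using tr_unique[OF t1] that by blast
      qed
    qed
    moreover have "\<exists>!g. g \<in> verts C1 \<rightarrow>\<^sub>E verts C2 \<and> (\<forall>t \<in> verts C1. d_map A (g t) = d_map A t)"
      unfolding verts
    proof (rule ex1I[of _ "restrict ?tr (SP.basin w1)"])
      show "restrict ?tr (SP.basin w1) \<in> SP.basin w1 \<rightarrow>\<^sub>E SP.basin w2 \<and>
          (\<forall>t \<in> SP.basin w1. d_map A (restrict ?tr (SP.basin w1) t) = d_map A t)"
        using tr d_tr by simp
      fix g
      assume g: "g \<in> SP.basin w1 \<rightarrow>\<^sub>E SP.basin w2 \<and> (\<forall>t \<in> SP.basin w1. d_map A (g t) = d_map A t)"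
      show "g = restrict ?tr (SP.basin w1)"
      proof (rule extensionalityI[of _ "SP.basin w1"])
        show "g t = restrict ?tr (SP.basin w1) t" if "t \<in> SP.basin w1" for t
          using tr_unique[OF that, of "g t"] g that by auto
      qed (use g in \<open>simp_all add: PiE_iff\<close>)
    qed
    moreover have "\<forall>g. g \<in> verts C1 \<rightarrow> verts C2 \<and> (\<forall>t \<in> verts C1. d_map A (g t) = d_map A t)
        \<longrightarrow> isomorphism_via g C1 C2"
      unfolding verts by (intro allI impI) (erule conjE, rule via)
    ultimately show ?thesis by (intro conjI)
  qed

  have depth_G: "depth (sign_transition_graph A) = Suc K"
    unfolding G by (rule SP.depth_transition)
  have depth_C: "depth (sign_transition_graph A) = depth C"
    if "C \<in> weak_components (sign_transition_graph A)" for C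
    using that depth_G SP.depth_basin by (auto simp: comps)

  obtain l where l: "\<And>r. r < K \<Longrightarrow> h ((h ^^ r) l) \<noteq> (h ^^ r) l" using late by blast
  \<comment> \<open>the arcs of the dependency graph point from \<open>h l\<close> to \<open>l\<close>, against those of the graph of \<open>h\<close>\<close>
  have "depth (sign_dependency_graph A) = depth (function_graph UNIV h)"
    by (rule depth_reversed)
      (auto simp: sign_dependency_graph_def h_def column_successor_def)
  also have "\<dots> = Suc K" using l by (intro D.depth_function_graph[of l]) auto
  finally have depth_D: "depth (sign_dependency_graph A) = Suc K" .

  have visited: "visited_columns (mat_abs A) j = (\<lambda>r. (h ^^ r) j) ` {..K}" for j
  proof -
    have "(\<lambda>l. max_in_row (mat_abs A) (max_in_col (mat_abs A) l)) = h"
      by (simp add: h_def column_successor_def[abs_def] jpos_def ipos_def)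
    then show ?thesis using D.orbit_eq_image[of j] by (simp add: visited_columns_def)
  qed
  have max_visited: "Max (range (\<lambda>j. card (visited_columns (mat_abs A) j))) = Suc K"
  proof (rule Max_eqI)
    show "y \<le> Suc K" if "y \<in> range (\<lambda>j. card (visited_columns (mat_abs A) j))" for y
      using that card_image_le[of "{..K}"] by (auto simp: visited)
    have "card (visited_columns (mat_abs A) l) = Suc K"
      using D.orbit_distinct[of l] l by (simp add: visited card_image)
    then show "Suc K \<in> range (\<lambda>j. card (visited_columns (mat_abs A) j))"
      by (metis rangeI)
  qed simp
  show ?thesis
    by (intro conjI)
      (intro ballI, erule (1) same, intro ballI, erule shape, rule number,
       intro ballI, erule (1) iso, intro ballI, erule depth_C,
       simp_all only: depth_G depth_D max_visited)
qed

end
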